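(* Let $\mathbb{K}$ be a field with $\operatorname{char}(\mathbb{K})=0$, let $D=C_2\times\{e_0,e_1\}$ be the generalized digroup with trivial action of $C_2=\{1,s\}$ on $\{e_0,e_1\}$, let $(V,\lambda,\rho)$ be the representation of $D$ on $V=\mathbb{K}^2$ given by $$\rho_{(g,e_i)}=\chi(g)I_2,\qquad \lambda_{(g,e_i)}=\chi(g)P_i\qquad(g\in C_2,\ i\in\{0,1\}),$$ where $\chi:C_2\to\mathbb{K}^\times$ is the character with $\chi(1)=1$, $\chi(s)=-1$, and $$P_0=\begin{pmatrix}1&0\\0&0\end{pmatrix},\qquad P_1=\begin{pmatrix}1&0\\1&0\end{pmatrix}.$$ Let $W=\operatorname{span}\{v_2\}\subseteq V$ with $v_2=\binom{0}{1}$, which is a subrepresentation, and let $Q=V/W$. Then the short exact sequence $0\to W\to V\to Q\to 0$ (inclusion and quotient map) is nonsplit in $\mathsf{Rep}(D)$.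
   Context: The generalized digroup $D=C_2\times\{e_0,e_1\}$ has operations $(g,e_i)\vdash(h,e_j)=(gh,e_j)$, $(g,e_i)\dashv(h,e_j)=(gh,e_i)$ and halo $\overline{E}=\{(1,e_0),(1,e_1)\}$. A representation of $D$ over $\mathbb{K}$ is a triple $(V,\lambda,\rho)$ where $V$ is a $\mathbb{K}$-vector space and $\lambda:D\to\operatorname{End}(V)$, $\rho:D\to\operatorname{Aut}(V)$ are maps such that for all $x,y\in D$ and $e\in\overline{E}$: $\lambda_{x\dashv y}=\lambda_x\lambda_y$, $\rho_{x\vdash y}=\rho_x\rho_y$, $\rho_e=\mathrm{id}_V$, $\rho_x\lambda_y=\lambda_{x\vdash y}$, $\lambda_x\rho_y=\lambda_{x\dashv y}$. A morphism of representations is a $\mathbb{K}$-linear map commuting with all $\lambda_x$ and $\rho_x$; these form the category $\mathsf{Rep}(D)$. A subrepresentation is a subspace stable under all $\lambda_x$ and $\rho_x$; the quotient carries the induced operators. *)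

theory Defs
  imports
    "Jordan_Normal_Form.VS_Connect"
    "HOL-Algebra.AbelCoset"
    "HOL-Algebra.Elementary_Groups"
begin

section \<open>The digroup $D = C_2 \times \{e_0, e_1\}$\<close>

record 'd digroup = "'d partial_object" +
  lprod :: "'d \<Rightarrow> 'd \<Rightarrow> 'd"  (infixl "\<turnstile>\<index>" 70)
  rprod :: "'d \<Rightarrow> 'd \<Rightarrow> 'd"  (infixl "\<stileturn>\<index>" 70)

definition halo :: "('d, 'e) digroup_scheme \<Rightarrow> 'd set" where
  "halo D = {e \<in> carrier D. \<forall>x \<in> carrier D. e \<turnstile>\<^bsub>D\<^esub> x = x \<and> x \<stileturn>\<^bsub>D\<^esub> e = x}"

text \<open>The generalized digroup attached to a group \<open>G\<close> acting trivially on a set \<open>E\<close>.\<close>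

definition trivial_action_digroup :: "('g, 'm) monoid_scheme \<Rightarrow> 'e set \<Rightarrow> ('g \<times> 'e) digroup" where
  "trivial_action_digroup G E =
    \<lparr>carrier = carrier G \<times> E,
     lprod = (\<lambda>(g, i) (h, j). (g \<otimes>\<^bsub>G\<^esub> h, j)),
     rprod = (\<lambda>(g, i) (h, j). (g \<otimes>\<^bsub>G\<^esub> h, i))\<rparr>"

text \<open>\<open>C2\<close> has carrier \<open>{0, 1}\<close> with addition modulo 2, so that the integers 0 and 1 stand for
  the elements $1$ and $s$; the natural numbers 0 and 1 stand for $e_0$ and $e_1$.\<close>

definition C2 :: "int monoid" where
  "C2 = integer_mod_group 2"

definition D2 :: "(int \<times> nat) digroup" where
  "D2 = trivial_action_digroup C2 {0, 1}"

lemma carrier_C2: "carrier C2 = {0, 1}"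
  unfolding C2_def carrier_integer_mod_group by auto

lemma halo_D2: "halo D2 = {(\<one>\<^bsub>C2\<^esub>, 0), (\<one>\<^bsub>C2\<^esub>, 1)}"
  unfolding halo_def D2_def trivial_action_digroup_def
  by (auto simp: carrier_C2) (auto simp: C2_def)


section \<open>Representations\<close>

record ('k, 'v, 'd) rep = "('k, 'v) module" +
  lam :: "'d \<Rightarrow> 'v \<Rightarrow> 'v"
  rho :: "'d \<Rightarrow> 'v \<Rightarrow> 'v"

locale digroup_rep = vectorspace K V
  for K :: "('k, 'a) ring_scheme" and D :: "('d, 'b) digroup_scheme"
    and V :: "('k, 'v, 'd, 'c) rep_scheme" +
  assumes lam_End: "x \<in> carrier D \<Longrightarrow> linear_map K V V (lam V x)"
    and rho_Aut: "x \<in> carrier D \<Longrightarrow>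
      linear_map K V V (rho V x) \<and> bij_betw (rho V x) (carrier V) (carrier V)"
    and lam_rprod: "\<lbrakk>x \<in> carrier D; y \<in> carrier D; v \<in> carrier V\<rbrakk> \<Longrightarrow>
      lam V (x \<stileturn>\<^bsub>D\<^esub> y) v = lam V x (lam V y v)"
    and rho_lprod: "\<lbrakk>x \<in> carrier D; y \<in> carrier D; v \<in> carrier V\<rbrakk> \<Longrightarrow>
      rho V (x \<turnstile>\<^bsub>D\<^esub> y) v = rho V x (rho V y v)"
    and rho_halo: "\<lbrakk>e \<in> halo D; v \<in> carrier V\<rbrakk> \<Longrightarrow> rho V e v = v"
    and rho_lam: "\<lbrakk>x \<in> carrier D; y \<in> carrier D; v \<in> carrier V\<rbrakk> \<Longrightarrow>
      rho V x (lam V y v) = lam V (x \<turnstile>\<^bsub>D\<^esub> y) v"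
    and lam_rho: "\<lbrakk>x \<in> carrier D; y \<in> carrier D; v \<in> carrier V\<rbrakk> \<Longrightarrow>
      lam V x (rho V y v) = lam V (x \<stileturn>\<^bsub>D\<^esub> y) v"

locale rep_hom = A?: digroup_rep K D A + B?: digroup_rep K D B + linear_map K A B f
  for K :: "('k, 'a) ring_scheme" and D :: "('d, 'b) digroup_scheme"
    and A :: "('k, 'v, 'd, 'c) rep_scheme" and B :: "('k, 'w, 'd, 'e) rep_scheme" and f +
  assumes hom_lam: "\<lbrakk>x \<in> carrier D; v \<in> carrier A\<rbrakk> \<Longrightarrow> f (lam A x v) = lam B x (f v)"
    and hom_rho: "\<lbrakk>x \<in> carrier D; v \<in> carrier A\<rbrakk> \<Longrightarrow> f (rho A x v) = rho B x (f v)"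

locale subrep = digroup_rep K D V + subspace K W V
  for K :: "('k, 'a) ring_scheme" and D :: "('d, 'b) digroup_scheme"
    and V :: "('k, 'v, 'd, 'c) rep_scheme" and W +
  assumes lam_stable: "\<lbrakk>x \<in> carrier D; w \<in> W\<rbrakk> \<Longrightarrow> lam V x w \<in> W"
    and rho_stable: "\<lbrakk>x \<in> carrier D; w \<in> W\<rbrakk> \<Longrightarrow> rho V x w \<in> W"

definition restrict_rep :: "('k, 'v, 'd) rep \<Rightarrow> 'v set \<Rightarrow> ('k, 'v, 'd) rep" where
  "restrict_rep V W = V\<lparr>carrier := W\<rparr>"

text \<open>If \<open>f\<close> is additive and maps \<open>W\<close> to itself, then \<open>induced_map V W f\<close> sends the coset of \<open>v\<close>
  to the coset of \<open>f v\<close>: all elements of $f(v + W)$ lie in $f(v) + W$. Adding \<open>W\<close> makes this a full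
  coset also where \<open>f\<close> does not map \<open>W\<close> onto itself, as for the scalar 0.\<close>

definition induced_map :: "('v, 'm) ring_scheme \<Rightarrow> 'v set \<Rightarrow> ('v \<Rightarrow> 'v) \<Rightarrow> 'v set \<Rightarrow> 'v set" where
  "induced_map V W f X = W <+>\<^bsub>V\<^esub> (f ` X)"

text \<open>The ring fields \<open>mult\<close> and \<open>one\<close> of a module record carry no meaning.\<close>

definition quotient_rep :: "('k, 'v, 'd) rep \<Rightarrow> 'v set \<Rightarrow> ('k, 'v set, 'd) rep" where
  "quotient_rep V W =
    \<lparr>carrier = a_rcosets\<^bsub>V\<^esub> W,
     mult = undefined,
     one = undefined,
     zero = W,
     add = set_add V,
     smult = (\<lambda>a. induced_map V W (\<lambda>v. a \<odot>\<^bsub>V\<^esub> v)),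
     lam = (\<lambda>x. induced_map V W (lam V x)),
     rho = (\<lambda>x. induced_map V W (rho V x))\<rparr>"


section \<open>Short exact sequences\<close>

locale short_exact_rep = i: rep_hom K D A B i + p: rep_hom K D B C p
  for K :: "('k, 'a) ring_scheme" and D :: "('d, 'b) digroup_scheme"
    and A :: "('k, 'u, 'd) rep" and i and B :: "('k, 'v, 'd) rep" and p
    and C :: "('k, 'w, 'd) rep" +
  assumes inj: "inj_on i (carrier A)"
    and exact: "i ` carrier A = a_kernel B C p"
    and surj: "p ` carrier B = carrier C"

definition split_rep ::
  "('k, 'a) ring_scheme \<Rightarrow> ('d, 'b) digroup_scheme \<Rightarrow>
   ('k, 'u, 'd) rep \<Rightarrow> ('u \<Rightarrow> 'v) \<Rightarrow> ('k, 'v, 'd) rep \<Rightarrow> ('v \<Rightarrow> 'w) \<Rightarrow> ('k, 'w, 'd) rep \<Rightarrow> bool" where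
  "split_rep K D A i B p C \<longleftrightarrow>
    short_exact_rep K D A i B p C \<and>
    (\<exists>\<sigma>. rep_hom K D C B \<sigma> \<and> (\<forall>z \<in> carrier C. p (\<sigma> z) = z))"


section \<open>The representation on $K^2$\<close>

definition chi :: "int \<Rightarrow> 'k::field" where
  "chi g = (if g = \<one>\<^bsub>C2\<^esub> then 1 else - 1)"

definition P :: "nat \<Rightarrow> 'k::field mat" where
  "P i = (if i = 0 then mat_of_rows_list 2 [[1, 0], [0, 0]]
          else mat_of_rows_list 2 [[1, 0], [1, 0]])"

definition V2 :: "('k::field, 'k vec, int \<times> nat) rep" where
  "V2 = module.extend (module_vec TYPE('k) 2)
    \<lparr>lam = (\<lambda>(g, i) v. (chi g \<cdot>\<^sub>m P i) *\<^sub>v v),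
     rho = (\<lambda>(g, i) v. (chi g \<cdot>\<^sub>m 1\<^sub>m 2) *\<^sub>v v)\<rparr>"

definition v\<^sub>2 :: "'k::field vec" where
  "v\<^sub>2 = vec_of_list [0, 1]"

end

theory Submission
  imports Defs
begin

text \<open>
  Why the sequence does not split. The vectors with first coordinate 0 form \<open>W\<close>, and both
  projections \<open>P 0\<close> and \<open>P 1\<close> agree modulo \<open>W\<close>, since they differ only in the second coordinate
  of their value. So \<open>(1, e\<^sub>0)\<close> and \<open>(1, e\<^sub>1)\<close> act in the same way on \<open>V/W\<close>. An equivariant
  section \<open>\<sigma>\<close> would send the coset of the first unit vector to a vector \<open>u\<close> with first
  coordinate 1 on which \<open>P 0\<close> and \<open>P 1\<close> take the same value; but \<open>P 0 u = (1, 0)\<close> and \<open>P 1 u = (1, 1)\<close>. This is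
  \<open>not_split_V2\<close>.

  Why the sequence is exact. This holds for every subrepresentation \<open>W\<close> of a representation \<open>V\<close> of
  a digroup whose elements have inverses up to the halo (\<open>short_exact_subrep_quotient\<close>). The
  operations on the cosets are well defined because \<open>W\<close> is stable (\<open>induced_map_coset\<close>), and the
  representation axioms that are equations pass to the image under the quotient map
  (\<open>rep_hom_surjective_image\<close>). What remains is the bijectivity of the \<open>\<rho>\<^sub>x\<close>: an invertible
  map that preserves \<open>W\<close> need not be onto \<open>W\<close> nor injective on \<open>V/W\<close>. The
  inverses in the digroup repair this, as they make the inverse of \<open>\<rho>\<^sub>x\<close> some \<open>\<rho>\<^sub>y\<close>, which
  preserves \<open>W\<close> too (\<open>bij_betw_rho\<close>).
\<close>

section \<open>Linear maps and invertible digroup elements\<close>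

lemma linear_map_iff:
  "linear_map K V W f \<longleftrightarrow>
    vectorspace K V \<and> vectorspace K W \<and> f \<in> LinearCombinations.module_hom K V W"
  by (auto simp: linear_map_def mod_hom_def mod_hom_axioms_def vectorspace_def)

text \<open>The two products lie in the halo but may be different halo elements: in \<open>D2\<close> the product
  \<open>x \<turnstile> y\<close> has the second component of \<open>y\<close>.\<close>

definition halo_invertible :: "('d, 'b) digroup_scheme \<Rightarrow> bool" where
  "halo_invertible D \<longleftrightarrow>
    (\<forall>x \<in> carrier D. \<exists>y \<in> carrier D. x \<turnstile>\<^bsub>D\<^esub> y \<in> halo D \<and> y \<turnstile>\<^bsub>D\<^esub> x \<in> halo D)"

text \<open>The family \<open>r\<close> on the bare set \<open>S\<close> makes this usable for restrictions and quotients before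
  they are known to be representations. The inverse of \<open>r x\<close> is \<open>r y\<close> for an inverse \<open>y\<close> of \<open>x\<close>.\<close>

lemma bij_betw_rho:
  assumes "halo_invertible D" and x: "x \<in> carrier D"
    and closed: "\<And>y v. \<lbrakk>y \<in> carrier D; v \<in> S\<rbrakk> \<Longrightarrow> r y v \<in> S"
    and prod: "\<And>y z v. \<lbrakk>y \<in> carrier D; z \<in> carrier D; v \<in> S\<rbrakk> \<Longrightarrow> r (y \<turnstile>\<^bsub>D\<^esub> z) v = r y (r z v)"
    and halo: "\<And>e v. \<lbrakk>e \<in> halo D; v \<in> S\<rbrakk> \<Longrightarrow> r e v = v"
  shows "bij_betw (r x) S S"
proof -
  obtain y where "y \<in> carrier D" "x \<turnstile>\<^bsub>D\<^esub> y \<in> halo D" "y \<turnstile>\<^bsub>D\<^esub> x \<in> halo D"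
    using assms(1) x unfolding halo_invertible_def by blast
  then show ?thesis
    using x closed by (intro bij_betwI[where g = "r y"]) (auto simp: prod[symmetric] halo)
qed


section \<open>Images and restrictions of representations\<close>

lemma module_surjective_image:
  assumes "Module.module K V"
    and surj: "p ` carrier V = carrier Q"
    and add: "\<And>u v. \<lbrakk>u \<in> carrier V; v \<in> carrier V\<rbrakk> \<Longrightarrow> p (u \<oplus>\<^bsub>V\<^esub> v) = p u \<oplus>\<^bsub>Q\<^esub> p v"
    and zero: "p \<zero>\<^bsub>V\<^esub> = \<zero>\<^bsub>Q\<^esub>"
    and smult: "\<And>a v. \<lbrakk>a \<in> carrier K; v \<in> carrier V\<rbrakk> \<Longrightarrow> p (a \<odot>\<^bsub>V\<^esub> v) = a \<odot>\<^bsub>Q\<^esub> p v"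
  shows "Module.module K Q"
proof -
  interpret Module.module K V by fact
  note push = surj[symmetric] add[symmetric] zero[symmetric] smult[symmetric]
  have neg: "\<exists>w \<in> carrier Q. z \<oplus>\<^bsub>Q\<^esub> w = \<zero>\<^bsub>Q\<^esub>" if z: "z \<in> carrier Q" for z
  proof -
    obtain v where v: "v \<in> carrier V" "z = p v"
      using z surj by auto
    then show ?thesis
      by (intro bexI[of _ "p (\<ominus>\<^bsub>V\<^esub> v)"]) (auto simp: push M.r_neg)
  qed
  show ?thesis
    by (rule module_criteria)
      (use neg in \<open>auto simp: push M.a_ac smult_assoc1 smult_l_distr smult_r_distr
        intro: R.is_cring\<close>)
qed

text \<open>Every element of \<open>Q\<close> is some \<open>p v\<close>, so an equation between operators on \<open>Q\<close> is the image of
  the same equation on \<open>V\<close>. The bijectivity of \<open>rho\<close> comes from the inverses in \<open>D\<close>.\<close>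

lemma rep_hom_surjective_image:
  fixes V :: "('k, 'v, 'd, 'c) rep_scheme" and Q :: "('k, 'w, 'd, 'e) rep_scheme"
  assumes "digroup_rep K D V" and "halo_invertible D"
    and surj: "p ` carrier V = carrier Q"
    and add: "\<And>u v. \<lbrakk>u \<in> carrier V; v \<in> carrier V\<rbrakk> \<Longrightarrow> p (u \<oplus>\<^bsub>V\<^esub> v) = p u \<oplus>\<^bsub>Q\<^esub> p v"
    and zero: "p \<zero>\<^bsub>V\<^esub> = \<zero>\<^bsub>Q\<^esub>"
    and smult: "\<And>a v. \<lbrakk>a \<in> carrier K; v \<in> carrier V\<rbrakk> \<Longrightarrow> p (a \<odot>\<^bsub>V\<^esub> v) = a \<odot>\<^bsub>Q\<^esub> p v"
    and lam: "\<And>x v. \<lbrakk>x \<in> carrier D; v \<in> carrier V\<rbrakk> \<Longrightarrow> p (lam V x v) = lam Q x (p v)"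
    and rho: "\<And>x v. \<lbrakk>x \<in> carrier D; v \<in> carrier V\<rbrakk> \<Longrightarrow> p (rho V x v) = rho Q x (p v)"
    and closed: "\<And>x y. \<lbrakk>x \<in> carrier D; y \<in> carrier D\<rbrakk> \<Longrightarrow>
      x \<turnstile>\<^bsub>D\<^esub> y \<in> carrier D \<and> x \<stileturn>\<^bsub>D\<^esub> y \<in> carrier D"
  shows "rep_hom K D V Q p"
proof -
  interpret V: digroup_rep K D V by fact
  have "Module.module K Q"
    using V.module_axioms surj add zero smult by (rule module_surjective_image)
  then have vsQ: "vectorspace K Q"
    by (intro vectorspace.intro V.field_axioms)
  have halo_carrier: "e \<in> carrier D" if "e \<in> halo D" for e
    using that by (simp add: halo_def)
  have lam_hom: "lam V x \<in> LinearCombinations.module_hom K V V"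
    and rho_hom: "rho V x \<in> LinearCombinations.module_hom K V V"
    if "x \<in> carrier D" for x
    using V.lam_End[OF that] V.rho_Aut[OF that] by (auto simp: linear_map_iff)
  note lam_simps = LinearCombinations.module_hom_closed[OF lam_hom, THEN funcset_mem]
    LinearCombinations.module_hom_add[OF lam_hom] LinearCombinations.module_hom_smult[OF lam_hom]
  note rho_simps = LinearCombinations.module_hom_closed[OF rho_hom, THEN funcset_mem]
    LinearCombinations.module_hom_add[OF rho_hom] LinearCombinations.module_hom_smult[OF rho_hom]
  \<comment> \<open>These rules rewrite every statement about \<open>Q\<close> into one about \<open>p\<close> of elements of \<open>V\<close>.\<close>
  note push = surj[symmetric] add[symmetric] zero[symmetric] smult[symmetric]
    lam[symmetric] rho[symmetric] closed halo_carrier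
  have lamQ: "lam Q x \<in> LinearCombinations.module_hom K Q Q"
    and rhoQ: "rho Q x \<in> LinearCombinations.module_hom K Q Q"
    if "x \<in> carrier D" for x
    using that by (auto simp: LinearCombinations.module_hom_def push lam_simps rho_simps)
  have rho_prod: "rho Q (x \<turnstile>\<^bsub>D\<^esub> y) z = rho Q x (rho Q y z)"
    if "x \<in> carrier D" "y \<in> carrier D" "z \<in> carrier Q" for x y z
    using that by (auto simp: push rho_simps V.rho_lprod)
  have rho_halo: "rho Q e z = z" if "e \<in> halo D" "z \<in> carrier Q" for e z
    using that by (auto simp: push rho_simps V.rho_halo)
  have "bij_betw (rho Q x) (carrier Q) (carrier Q)" if "x \<in> carrier D" for x
    using \<open>halo_invertible D\<close> that
    by (rule bij_betw_rho)
      (use LinearCombinations.module_hom_closed[OF rhoQ] rho_prod rho_halo in auto)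
  then have "digroup_rep K D Q"
    using vsQ lamQ rhoQ rho_prod rho_halo
    by (intro digroup_rep.intro digroup_rep_axioms.intro)
      (auto simp: linear_map_iff push lam_simps rho_simps V.lam_rprod V.rho_lam V.lam_rho)
  moreover have "linear_map K V Q p"
    using vsQ V.vectorspace_axioms
    by (auto simp: linear_map_iff LinearCombinations.module_hom_def push)
  ultimately show ?thesis
    using V.digroup_rep_axioms
    by (intro rep_hom.intro rep_hom_axioms.intro) (auto simp: lam rho)
qed

lemma rep_hom_restrict:
  assumes "subrep K D V W" and "halo_invertible D"
  shows "rep_hom K D (restrict_rep V W) V (\<lambda>w. w)"
proof -
  interpret subrep K D V W by fact
  have sub: "\<And>w. w \<in> W \<Longrightarrow> w \<in> carrier V"
    using submod by (auto simp: submodule_def)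
  let ?W = "restrict_rep V W"
  have vsW: "vectorspace K (restrict_rep V W)"
    using subspace_is_vs[OF subspace_axioms] by (simp add: restrict_rep_def)
  have lam_hom: "lam V x \<in> LinearCombinations.module_hom K V V"
    and rho_hom: "rho V x \<in> LinearCombinations.module_hom K V V"
    if "x \<in> carrier D" for x
    using lam_End[OF that] rho_Aut[OF that] by (auto simp: linear_map_iff)
  have homs: "lam V x \<in> LinearCombinations.module_hom K ?W ?W"
    "rho V x \<in> LinearCombinations.module_hom K ?W ?W" if "x \<in> carrier D" for x
    using lam_hom[OF that] rho_hom[OF that] lam_stable[OF that] rho_stable[OF that] sub
    by (auto simp: LinearCombinations.module_hom_def restrict_rep_def)
  have "bij_betw (rho V x) W W" if "x \<in> carrier D" for x
    using assms(2) that
    by (rule bij_betw_rho) (auto simp: rho_stable rho_lprod rho_halo sub)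
  then have "digroup_rep K D (restrict_rep V W)"
    using vsW homs
    by (intro digroup_rep.intro digroup_rep_axioms.intro)
      (auto simp: linear_map_iff restrict_rep_def sub lam_rprod rho_lprod rho_halo rho_lam lam_rho)
  moreover have "linear_map K (restrict_rep V W) V (\<lambda>w. w)"
    using vsW vectorspace_axioms sub
    by (auto simp: linear_map_iff LinearCombinations.module_hom_def restrict_rep_def)
  ultimately show ?thesis
    using digroup_rep_axioms
    by (intro rep_hom.intro rep_hom_axioms.intro) (auto simp: restrict_rep_def)
qed


section \<open>The quotient by a subrepresentation\<close>

text \<open>A subspace contains negatives because it is closed under the scalar \<open>-1\<close>.\<close>

lemma (in subrep) abelian_subgroup: "abelian_subgroup W V"
proof -
  interpret S: LinearCombinations.submodule K W V by (rule submod)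
  have "\<ominus>\<^bsub>V\<^esub> w \<in> W" if "w \<in> W" for w
  proof -
    have "\<ominus>\<^bsub>K\<^esub> \<one>\<^bsub>K\<^esub> \<odot>\<^bsub>V\<^esub> w \<in> W"
      using that by (intro S.smult_closed R.a_inv_closed R.one_closed)
    then show ?thesis
      using that S.subset by (metis smult_minus_1 subsetD)
  qed
  then have "subgroup W (add_monoid V)"
    using S.subset S.zero_closed
    by (intro group.subgroupI[OF M.a_group]) (auto simp: a_inv_def simp del: S.zero_closed)
  then show ?thesis
    by (intro abelian_subgroupI3 additive_subgroup.intro M.abelian_group_axioms)
qed

text \<open>\<open>f (w' + v) = f w' + f v\<close> with \<open>f w' \<in> W\<close>, so the image of a coset stays inside one coset, and
  the summand \<open>W\<close> in \<open>induced_map\<close> fills it up.\<close>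

lemma (in subrep) induced_map_coset:
  assumes f: "f \<in> carrier V \<rightarrow> carrier V"
    and add: "\<And>u v. \<lbrakk>u \<in> carrier V; v \<in> carrier V\<rbrakk> \<Longrightarrow> f (u \<oplus>\<^bsub>V\<^esub> v) = f u \<oplus>\<^bsub>V\<^esub> f v"
    and stable: "\<And>w. w \<in> W \<Longrightarrow> f w \<in> W"
    and v: "v \<in> carrier V"
  shows "induced_map V W f (W +>\<^bsub>V\<^esub> v) = W +>\<^bsub>V\<^esub> f v"
proof -
  interpret S: abelian_subgroup W V by (rule abelian_subgroup)
  have fv: "f v \<in> carrier V" using f v by auto
  have *: "w \<oplus>\<^bsub>V\<^esub> f (w' \<oplus>\<^bsub>V\<^esub> v) = (w \<oplus>\<^bsub>V\<^esub> f w') \<oplus>\<^bsub>V\<^esub> f v"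
    if "w \<in> W" "w' \<in> W" for w w'
    using that v fv funcset_mem[OF f] by (subst add) (auto simp: M.a_assoc)
  show ?thesis
  proof (intro equalityI subsetI)
    fix z assume "z \<in> induced_map V W f (W +>\<^bsub>V\<^esub> v)"
    then obtain w w' where "w \<in> W" "w' \<in> W" "z = w \<oplus>\<^bsub>V\<^esub> f (w' \<oplus>\<^bsub>V\<^esub> v)"
      by (auto simp: induced_map_def set_add_def' a_r_coset_def')
    then show "z \<in> W +>\<^bsub>V\<^esub> f v"
      unfolding a_r_coset_def' using * stable by auto
  next
    fix z assume "z \<in> W +>\<^bsub>V\<^esub> f v"
    then obtain w where "w \<in> W" "z = w \<oplus>\<^bsub>V\<^esub> f v"
      by (auto simp: a_r_coset_def')
    then show "z \<in> induced_map V W f (W +>\<^bsub>V\<^esub> v)"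
      using S.a_rcos_self[OF v] by (auto simp: induced_map_def set_add_def')
  qed
qed

lemma short_exact_subrep_quotient:
  fixes V :: "('k, 'v, 'd) rep"
  assumes "subrep K D V W" and "halo_invertible D"
    and closed: "\<And>x y. \<lbrakk>x \<in> carrier D; y \<in> carrier D\<rbrakk> \<Longrightarrow>
      x \<turnstile>\<^bsub>D\<^esub> y \<in> carrier D \<and> x \<stileturn>\<^bsub>D\<^esub> y \<in> carrier D"
  shows "short_exact_rep K D (restrict_rep V W) (\<lambda>w. w) V (\<lambda>v. W +>\<^bsub>V\<^esub> v) (quotient_rep V W)"
proof -
  interpret subrep K D V W by fact
  interpret S: abelian_subgroup W V by (rule abelian_subgroup)
  interpret T: LinearCombinations.submodule K W V by (rule submod)
  let ?Q = "quotient_rep V W" and ?p = "\<lambda>v. W +>\<^bsub>V\<^esub> v"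
  have lam_hom: "lam V x \<in> LinearCombinations.module_hom K V V"
    and rho_hom: "rho V x \<in> LinearCombinations.module_hom K V V"
    if "x \<in> carrier D" for x
    using lam_End[OF that] rho_Aut[OF that] by (auto simp: linear_map_iff)
  have surj: "?p ` carrier V = carrier ?Q"
    by (auto simp: quotient_rep_def A_RCOSETS_def')
  have "rep_hom K D V ?Q ?p"
  proof (rule rep_hom_surjective_image[OF digroup_rep_axioms assms(2) surj])
    show "?p (u \<oplus>\<^bsub>V\<^esub> v) = ?p u \<oplus>\<^bsub>?Q\<^esub> ?p v" if "u \<in> carrier V" "v \<in> carrier V" for u v
      using that by (simp add: quotient_rep_def S.a_rcos_sum)
    show "?p \<zero>\<^bsub>V\<^esub> = \<zero>\<^bsub>?Q\<^esub>"
      by (simp add: quotient_rep_def S.a_rcos_const)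
    show "?p (a \<odot>\<^bsub>V\<^esub> v) = a \<odot>\<^bsub>?Q\<^esub> ?p v" if "a \<in> carrier K" "v \<in> carrier V" for a v
      using that by (simp add: quotient_rep_def induced_map_coset smult_r_distr)
    show "?p (lam V x v) = lam ?Q x (?p v)" if "x \<in> carrier D" "v \<in> carrier V" for x v
      using that lam_hom[OF that(1)]
      by (simp add: quotient_rep_def induced_map_coset LinearCombinations.module_hom_def lam_stable)
    show "?p (rho V x v) = rho ?Q x (?p v)" if "x \<in> carrier D" "v \<in> carrier V" for x v
      using that rho_hom[OF that(1)]
      by (simp add: quotient_rep_def induced_map_coset LinearCombinations.module_hom_def rho_stable)
  qed (use closed in auto)
  moreover have "W = a_kernel V ?Q ?p"
    using S.a_rcos_const S.a_rcos_self T.subset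
    by (auto simp: a_kernel_def' quotient_rep_def)
  ultimately show ?thesis
    using rep_hom_restrict[OF assms(1,2)] surj
    by (intro short_exact_rep.intro short_exact_rep_axioms.intro) (auto simp: restrict_rep_def)
qed


section \<open>The digroup and its representation on the plane\<close>

lemma D2_simps:
  "carrier D2 = {0, 1} \<times> {0, 1}"
  "(g, i) \<turnstile>\<^bsub>D2\<^esub> (h, j) = (g \<otimes>\<^bsub>C2\<^esub> h, j)"
  "(g, i) \<stileturn>\<^bsub>D2\<^esub> (h, j) = (g \<otimes>\<^bsub>C2\<^esub> h, i)"
  by (simp_all add: D2_def trivial_action_digroup_def carrier_C2)

lemma C2_simps: "\<one>\<^bsub>C2\<^esub> = 0" "g \<otimes>\<^bsub>C2\<^esub> h = (g + h) mod 2"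
  by (simp_all add: C2_def integer_mod_group_def)

lemma D2_closed:
  assumes "x \<in> carrier D2" "y \<in> carrier D2"
  shows "x \<turnstile>\<^bsub>D2\<^esub> y \<in> carrier D2 \<and> x \<stileturn>\<^bsub>D2\<^esub> y \<in> carrier D2"
  using assms by (auto simp: D2_simps C2_simps)

lemma halo_invertible_D2: "halo_invertible D2"
  unfolding halo_invertible_def
proof
  fix x assume "x \<in> carrier D2"
  \<comment> \<open>Both elements of \<open>C2\<close> are involutions, so each \<open>x\<close> is its own inverse.\<close>
  then show "\<exists>y \<in> carrier D2. x \<turnstile>\<^bsub>D2\<^esub> y \<in> halo D2 \<and> y \<turnstile>\<^bsub>D2\<^esub> x \<in> halo D2"
    by (intro bexI[of _ x]) (auto simp: halo_D2 D2_simps C2_simps)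
qed

lemma chi_mult:
  assumes "g \<in> {0, 1}" "h \<in> {0, 1}"
  shows "chi (g \<otimes>\<^bsub>C2\<^esub> h) = (chi g * chi h :: 'k::field)"
  using assms by (auto simp: chi_def C2_simps)

lemma V2_simps:
  "carrier (V2 :: ('k::field, 'k vec, int \<times> nat) rep) = carrier_vec 2"
  "zero (V2 :: ('k, 'k vec, int \<times> nat) rep) = 0\<^sub>v 2"
  "add (V2 :: ('k, 'k vec, int \<times> nat) rep) = (+)"
  "smult (V2 :: ('k, 'k vec, int \<times> nat) rep) = (\<cdot>\<^sub>v)"
  "lam (V2 :: ('k, 'k vec, int \<times> nat) rep) (g, i) v = (chi g \<cdot>\<^sub>m P i) *\<^sub>v v"
  "rho (V2 :: ('k, 'k vec, int \<times> nat) rep) (g, i) v = (chi g \<cdot>\<^sub>m 1\<^sub>m 2) *\<^sub>v v"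
  by (simp_all add: V2_def module.extend_def module_vec_simps)

lemma smult_mat_mult_vec:
  fixes v :: "'k::comm_semiring_0 vec"
  assumes "A \<in> carrier_mat n m" "v \<in> carrier_vec m"
  shows "(c \<cdot>\<^sub>m A) *\<^sub>v v = c \<cdot>\<^sub>v (A *\<^sub>v v)"
  using assms by (intro eq_vecI) (auto simp: scalar_prod_def sum_distrib_left mult.assoc)

lemma P_carrier: "P i \<in> carrier_mat 2 2"
  by (simp add: P_def mat_of_rows_list_def numeral_2_eq_2)

lemma P_index:
  assumes "a < 2" "b < 2"
  shows "(P i :: 'k::field mat) $$ (a, b) = (if b = 0 \<and> (a = 0 \<or> i \<noteq> 0) then 1 else 0)"
  using assms by (auto simp: P_def mat_of_rows_list_def less_2_cases_iff)

text \<open>Both matrices keep the first coordinate and have a value that depends on it alone. Hence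
  \<open>P i * P j = P i\<close>, which together with the multiplicativity of \<open>chi\<close> yields the axioms on \<open>lam\<close>,
  and \<open>P i\<close> kills \<open>v\<^sub>2\<close>.\<close>

lemma P_mult_vec:
  fixes v :: "'k::field vec"
  assumes "v \<in> carrier_vec 2"
  shows "P i *\<^sub>v v = vec 2 (\<lambda>a. if a = 0 \<or> i \<noteq> 0 then v $ 0 else 0)"
proof (rule eq_vecI)
  fix a assume "a < dim_vec (vec 2 (\<lambda>a. if a = 0 \<or> i \<noteq> 0 then v $ 0 else 0))"
  then have a: "a < 2" by simp
  then have "(P i *\<^sub>v v) $ a = (\<Sum>b<2. P i $$ (a, b) * v $ b)"
    using assms P_carrier[of i, where ?'a = 'k] by (auto simp: scalar_prod_def lessThan_atLeast0)
  then show "(P i *\<^sub>v v) $ a = vec 2 (\<lambda>a. if a = 0 \<or> i \<noteq> 0 then v $ 0 else 0) $ a"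
    using a by (simp add: P_index lessThan_nat_numeral lessThan_Suc)
qed (use P_carrier[of i, where ?'a = 'k] in auto)

lemma lam_V2:
  assumes "v \<in> carrier_vec 2"
  shows "lam V2 (g, i) v = chi g \<cdot>\<^sub>v vec 2 (\<lambda>a. if a = 0 \<or> i \<noteq> 0 then v $ 0 else 0)"
  using assms P_carrier[of i, where ?'a = 'a]
  by (simp add: V2_simps smult_mat_mult_vec[of _ 2 2] P_mult_vec)

lemma rho_V2:
  assumes "v \<in> carrier_vec 2"
  shows "rho V2 (g, i) v = chi g \<cdot>\<^sub>v v"
  using assms by (simp add: V2_simps smult_mat_mult_vec[of _ 2 2])

lemma vectorspace_V2: "vectorspace class_ring (V2 :: ('k::field, 'k vec, int \<times> nat) rep)"
proof -
  interpret M: Module.module "class_ring :: 'k ring" "module_vec TYPE('k) 2" by (rule vec_module)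
  have "Module.module class_ring (V2 :: ('k, 'k vec, int \<times> nat) rep)"
    by (rule module_surjective_image[OF M.module_axioms, where p = "\<lambda>v. v"])
      (auto simp: V2_simps module_vec_simps)
  then show ?thesis
    by (intro vectorspace.intro class_field)
qed

lemma digroup_rep_V2: "digroup_rep class_ring D2 (V2 :: ('k::field, 'k vec, int \<times> nat) rep)"
proof -
  let ?V = "V2 :: ('k, 'k vec, int \<times> nat) rep"
  have hom: "(*\<^sub>v) A \<in> LinearCombinations.module_hom class_ring ?V ?V"
    if "A \<in> carrier_mat 2 2" for A
    using that
    by (auto simp: LinearCombinations.module_hom_def V2_simps mult_add_distrib_mat_vec mult_mat_vec)
  have homs: "lam ?V x \<in> LinearCombinations.module_hom class_ring ?V ?V"
    "rho ?V x \<in> LinearCombinations.module_hom class_ring ?V ?V" for x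
  proof -
    have "lam ?V x = (*\<^sub>v) (chi (fst x) \<cdot>\<^sub>m P (snd x))"
      "rho ?V x = (*\<^sub>v) (chi (fst x) \<cdot>\<^sub>m 1\<^sub>m 2)"
      by (simp_all add: V2_def module.extend_def case_prod_unfold)
    then show "lam ?V x \<in> LinearCombinations.module_hom class_ring ?V ?V"
      "rho ?V x \<in> LinearCombinations.module_hom class_ring ?V ?V"
      using hom[OF smult_carrier_mat[OF P_carrier]] hom[OF smult_carrier_mat[OF one_carrier_mat]]
      by simp_all
  qed
  have rho_prod: "rho ?V (x \<turnstile>\<^bsub>D2\<^esub> y) v = rho ?V x (rho ?V y v)"
    if "x \<in> carrier D2" "y \<in> carrier D2" "v \<in> carrier ?V" for x y v
    using that by (auto simp: D2_simps rho_V2 V2_simps(1) chi_mult smult_smult_assoc)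
  have rho_halo: "rho ?V e v = v" if "e \<in> halo D2" "v \<in> carrier ?V" for e v
    using that by (auto simp: halo_D2 rho_V2 V2_simps(1) chi_def)
  have "bij_betw (rho ?V x) (carrier ?V) (carrier ?V)" if "x \<in> carrier D2" for x
    using halo_invertible_D2 that
    by (rule bij_betw_rho)
      (use LinearCombinations.module_hom_closed[OF homs(2)] rho_prod rho_halo in auto)
  moreover have "lam ?V (x \<stileturn>\<^bsub>D2\<^esub> y) v = lam ?V x (lam ?V y v)"
    "rho ?V x (lam ?V y v) = lam ?V (x \<turnstile>\<^bsub>D2\<^esub> y) v"
    "lam ?V x (rho ?V y v) = lam ?V (x \<stileturn>\<^bsub>D2\<^esub> y) v"
    if xy: "x \<in> carrier D2" "y \<in> carrier D2" and v: "v \<in> carrier ?V" for x y v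
  proof -
    obtain g i h j where "x = (g, i)" "y = (h, j)" "g \<in> {0, 1}" "h \<in> {0, 1}"
      using xy by (auto simp: D2_simps)
    then show "lam ?V (x \<stileturn>\<^bsub>D2\<^esub> y) v = lam ?V x (lam ?V y v)"
      "rho ?V x (lam ?V y v) = lam ?V (x \<turnstile>\<^bsub>D2\<^esub> y) v"
      "lam ?V x (rho ?V y v) = lam ?V (x \<stileturn>\<^bsub>D2\<^esub> y) v"
      using v by (simp_all add: D2_simps(2,3) V2_simps(1) lam_V2 rho_V2 chi_mult)
        (rule eq_vecI; simp)+
  qed
  ultimately show ?thesis
    using vectorspace_V2 homs rho_prod rho_halo
    by (intro digroup_rep.intro digroup_rep_axioms.intro) (simp_all only: linear_map_iff simp_thms)
qed

lemma span_v2: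
  "LinearCombinations.module.span class_ring (V2 :: ('k::field, 'k vec, int \<times> nat) rep) {v\<^sub>2}
    = {v \<in> carrier_vec 2. v $ 0 = 0}"
proof -
  let ?V = "V2 :: ('k, 'k vec, int \<times> nat) rep"
  interpret vectorspace class_ring ?V by (rule vectorspace_V2)
  have v2: "v\<^sub>2 \<in> carrier ?V"
    by (simp add: V2_simps v\<^sub>2_def carrier_vecI)
  have lincomb: "lincomb a {v\<^sub>2} = a v\<^sub>2 \<cdot>\<^sub>v v\<^sub>2" for a
    using v2 by (simp add: lincomb_def V2_simps)
  have "v = v $ 1 \<cdot>\<^sub>v v\<^sub>2" if "v \<in> carrier_vec 2" "v $ 0 = 0" for v :: "'k vec"
    using that by (intro eq_vecI) (auto simp: v\<^sub>2_def numeral_2_eq_2 less_Suc_eq)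
  moreover have "c \<cdot>\<^sub>v v\<^sub>2 \<in> carrier_vec 2" "(c \<cdot>\<^sub>v v\<^sub>2) $ 0 = 0" for c :: 'k
    by (simp_all add: v\<^sub>2_def carrier_vecI)
  ultimately have *: "{v \<in> carrier_vec 2. v $ 0 = 0} = {c \<cdot>\<^sub>v v\<^sub>2 | c :: 'k. True}"
    by blast
  have "span {v\<^sub>2} = {a v\<^sub>2 \<cdot>\<^sub>v v\<^sub>2 | a :: 'k vec \<Rightarrow> 'k. True}"
    using v2 by (simp add: finite_span lincomb)
  also have "\<dots> = {c \<cdot>\<^sub>v v\<^sub>2 | c :: 'k. True}"
    by (auto intro: exI[of _ "\<lambda>_. _"])
  finally show ?thesis
    by (simp add: *)
qed

lemma subrep_span_v2:
  "subrep class_ring D2 (V2 :: ('k::field, 'k vec, int \<times> nat) rep)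
    {v \<in> carrier_vec 2. v $ 0 = 0}"
proof -
  let ?V = "V2 :: ('k, 'k vec, int \<times> nat) rep"
  interpret vectorspace class_ring ?V by (rule vectorspace_V2)
  have "{v\<^sub>2} \<subseteq> carrier ?V"
    by (simp add: V2_simps v\<^sub>2_def carrier_vecI)
  from span_is_submodule[OF this] show ?thesis
    by (intro subrep.intro subrep_axioms.intro subspace.intro digroup_rep_V2 vectorspace_V2)
      (auto simp: span_v2 D2_simps lam_V2 rho_V2)
qed

text \<open>The operators of \<open>(1, e\<^sub>0)\<close> and \<open>(1, e\<^sub>1)\<close> agree on the quotient but on no vector outside
  \<open>W\<close>, whereas the image of a section contains such vectors.\<close>

lemma not_split_V2:
  fixes W :: "'k::field vec set"
  defines "W \<equiv> {v \<in> carrier_vec 2. v $ 0 = 0}"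
  shows "\<not> split_rep class_ring D2 (restrict_rep V2 W) (\<lambda>w. w)
    V2 (\<lambda>v. W +>\<^bsub>V2\<^esub> v) (quotient_rep V2 W)"
proof
  let ?V = "V2 :: ('k, 'k vec, int \<times> nat) rep" and ?K = "class_ring :: 'k ring"
  let ?p = "\<lambda>v. W +>\<^bsub>?V\<^esub> v" and ?Q = "quotient_rep ?V W"
  assume "split_rep ?K D2 (restrict_rep ?V W) (\<lambda>w. w) ?V ?p ?Q"
  then obtain \<sigma> where exact: "short_exact_rep ?K D2 (restrict_rep ?V W) (\<lambda>w. w) ?V ?p ?Q"
    and \<sigma>: "rep_hom ?K D2 ?Q ?V \<sigma>" and right_inv: "\<And>z. z \<in> carrier ?Q \<Longrightarrow> ?p (\<sigma> z) = z"
    unfolding split_rep_def by blast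
  interpret E: short_exact_rep ?K D2 "restrict_rep ?V W" "\<lambda>w. w" ?V ?p ?Q by (rule exact)
  interpret \<sigma>: rep_hom ?K D2 ?Q ?V \<sigma> by (rule \<sigma>)
  interpret S: abelian_subgroup W ?V
    using subrep.abelian_subgroup[OF subrep_span_v2] by (simp add: W_def)
  define z where "z = ?p (unit_vec 2 0)"
  have z: "z \<in> carrier ?Q"
    using E.surj by (auto simp: z_def V2_simps)
  define u where "u = \<sigma> z"
  have u: "u \<in> carrier_vec 2"
    using \<sigma>.f_im[OF z] by (simp add: u_def V2_simps)
  have pu: "?p u = z"
    using right_inv[OF z] by (simp add: u_def)
  have "u \<in> ?p (unit_vec 2 0)"
    using S.a_rcos_self[of u] u unfolding pu z_def by (simp add: V2_simps(1))
  then obtain w where "w \<in> W" "u = w + unit_vec 2 0"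
    unfolding a_r_coset_def' V2_simps(3) by blast
  then have u0: "u $ 0 = 1"
    by (simp add: W_def)
  have lam_z: "lam ?Q (0, i) z = ?p (lam ?V (0, i) (unit_vec 2 0))" if "i \<in> {0, 1}" for i
    using E.p.hom_lam[of "(0, i)" "unit_vec 2 0"] that by (simp add: z_def D2_simps V2_simps(1))
  \<comment> \<open>The values of \<open>P 1\<close> and \<open>P 0\<close> at the first unit vector differ by \<open>v\<^sub>2\<close>, which lies in \<open>W\<close>.\<close>
  have "lam ?V (0, 1) (unit_vec 2 0) = unit_vec 2 1 + lam ?V (0, 0) (unit_vec 2 0)"
    by (intro eq_vecI) (auto simp: lam_V2 chi_def C2_simps less_2_cases_iff)
  moreover have "unit_vec 2 1 \<in> W"
    by (simp add: W_def)
  ultimately have "lam ?V (0, 1) (unit_vec 2 0) \<in> ?p (lam ?V (0, 0) (unit_vec 2 0))"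
    by (auto simp: a_r_coset_def' V2_simps(3))
  then have "?p (lam ?V (0, 0) (unit_vec 2 0)) = ?p (lam ?V (0, 1) (unit_vec 2 0))"
    by (rule S.a_repr_independence') (simp add: lam_V2 V2_simps(1))
  then have "lam ?Q (0, 0) z = lam ?Q (0, 1) z"
    by (simp add: lam_z)
  moreover have "lam ?V (0, i) u = \<sigma> (lam ?Q (0, i) z)" if "i \<in> {0, 1}" for i
    using \<sigma>.hom_lam[of "(0, i)" z] z that by (simp add: u_def D2_simps(1))
  ultimately have "lam ?V (0, 0) u = lam ?V (0, 1) u"
    by simp
  then have "lam ?V (0, 0) u $ 1 = lam ?V (0, 1) u $ 1"
    by simp
  then show False
    using u u0 by (simp add: lam_V2 chi_def C2_simps)
qed

theorem proposition41:
  fixes K :: "'k::field_char_0 ring"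
    and V :: "('k, 'k vec, int \<times> nat) rep"
    and W :: "'k vec set"
    and Q :: "('k, 'k vec set, int \<times> nat) rep"
  assumes "K = class_ring"
    and "V = V2"
    and "W = LinearCombinations.module.span K V {v\<^sub>2}"
    and "Q = quotient_rep V W"
  shows "digroup_rep K D2 V \<and>
         subrep K D2 V W \<and>
         short_exact_rep K D2 (restrict_rep V W) (\<lambda>w. w) V (\<lambda>v. W +>\<^bsub>V\<^esub> v) Q \<and>
         \<not> split_rep K D2 (restrict_rep V W) (\<lambda>w. w) V (\<lambda>v. W +>\<^bsub>V\<^esub> v) Q"
proof -
  have W: "W = {v \<in> carrier_vec 2. v $ 0 = 0}"
    using assms(1-3) by (simp add: span_v2)
  have "subrep K D2 V W"
    using subrep_span_v2 assms(1,2) W by simp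
  from this halo_invertible_D2 D2_closed
  have "short_exact_rep K D2 (restrict_rep V W) (\<lambda>w. w) V (\<lambda>v. W +>\<^bsub>V\<^esub> v) (quotient_rep V W)"
    by (rule short_exact_subrep_quotient)
  then show ?thesis
    using \<open>subrep K D2 V W\<close> digroup_rep_V2 not_split_V2 assms(1,2,4) W by simp
qed

end
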